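(* Let $k,n$ be integers with $k\geq 3$ and $n\neq 0$. Let $M=\{x^k+n: x\in\mathbb{N}\}\cap\mathbb{N}$. Let $R\subset\mathbb{N}$ be any set obtained from $M$ by changing $o(X^{1/k})$ elements up to $X$, that is, any set $R\subset \mathbb{N}$ such that $$|\{m\in (R\setminus M)\cup(M\setminus R): m\leq X\}|=o(X^{1/k})\quad\text{as } X\to\infty.$$ Then $R$ is multiplicatively irreducible.
   Context: $\mathbb{N}$ denotes the set of positive integers. A set $S\subset\mathbb{N}$ is multiplicatively reducible if there exist subsets $A,B\subset\mathbb{N}$, each with at least $2$ elements (possibly infinite), such that $S=AB=\{ab: a\in A, b\in B\}$. If $S$ is not multiplicatively reducible, it is called multiplicatively irreducible. Changing elements of a set means deleting some of its elements and adding some positive integers. *)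

theory Defs
  imports Complex_Main "HOL-Library.Landau_Symbols" "HOL-Library.Set_Algebras"
begin

text \<open>
  Sets of positive integers are rendered as subsets of \<open>{0<..}\<close> in \<^typ>\<open>nat\<close>.
  The product \<open>A * B\<close> of two sets is the elementwise product from
  \<^theory>\<open>HOL-Library.Set_Algebras\<close>.
\<close>

text \<open>The first disjunct is needed because \<^const>\<open>card\<close> is \<open>0\<close> on infinite sets.\<close>

definition at_least_two_elements :: "nat set \<Rightarrow> bool" where
  "at_least_two_elements A \<longleftrightarrow> infinite A \<or> card A \<ge> 2"

definition mult_reducible :: "nat set \<Rightarrow> bool" where
  "mult_reducible S \<longleftrightarrow>
     (\<exists>A B. A \<subseteq> {0<..} \<and> B \<subseteq> {0<..} \<and>
            at_least_two_elements A \<and> at_least_two_elements B \<and> S = A * B)"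

definition mult_irreducible :: "nat set \<Rightarrow> bool" where
  "mult_irreducible S \<longleftrightarrow> \<not> mult_reducible S"

text \<open>The equation is stated in \<^typ>\<open>int\<close>, since the shift \<open>n\<close> may be negative.\<close>

definition shifted_powers :: "nat \<Rightarrow> int \<Rightarrow> nat set" where
  "shifted_powers k n = {m. m > 0 \<and> (\<exists>x::nat. x > 0 \<and> int m = int x ^ k + n)}"

end

theory Submission
  imports Defs "HOL-Real_Asymp.Real_Asymp"
begin

text \<open>
  Let \<open>M\<close> be the set of shifted powers and suppose \<open>R = A B\<close>. Everything rests on one gap
  principle (\<open>rectangle_root_gap\<close>): if \<open>a1 < a2\<close>, \<open>b1 < b2\<close> and all four products \<open>ai bj\<close> lie
  in \<open>M\<close>, then the \<open>k\<close>-th root \<open>x4\<close> belonging to the largest product is at least of the order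
  of the square of the root \<open>x1\<close> belonging to the smallest one. The identity
  \<open>(a1 b1)(a2 b2) = (a1 b2)(a2 b1)\<close> makes two \<open>k\<close>-th powers, \<open>(x1 x4)^k\<close> and \<open>(x2 x3)^k\<close>,
  differ by a nonzero amount of size at most \<open>\<bar>n\<bar> x4^k\<close>, whereas distinct \<open>k\<close>-th powers are
  far apart; this is where \<open>k \<ge> 3\<close> enters.

  The principle is used twice. First, fix two elements \<open>b1 < b2\<close> of \<open>B\<close>. Apart from the few
  \<open>a\<close> for which \<open>a b1\<close> or \<open>a b2\<close> is an exceptional element of \<open>R - M\<close>, both products are in
  \<open>M\<close>, and then for all such \<open>a \<le> X\<close> but the largest the root of \<open>a b1\<close> is
  \<open>O(X^(1/(2k)))\<close>. Hence \<open>A\<close>,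
  and by symmetry \<open>B\<close>, has only \<open>o(X^(1/k))\<close> elements up to \<open>X\<close> (\<open>negligible_factor\<close>).

  Secondly, put \<open>X = t^(2k)\<close> and consider the \<open>x^k + n\<close> with \<open>\<bar>n\<bar> t < x \<le> t^2\<close>: there
  are \<open>t^2 - O(t)\<close> of them, and all but \<open>o(t^2)\<close> are products \<open>a b\<close>. View these pairs
  \<open>(a, b)\<close> as edges of a bipartite graph. The roots lie in so short a range that by the gap
  principle the graph has no 4-cycle. One of the factors is \<open>O(t^k)\<close>; if it is \<open>a\<close>, there
  are only \<open>o(t)\<close> choices for it and \<open>o(t^2)\<close> for \<open>b\<close>. A graph without 4-cycles between
  sides of sizes \<open>s\<close> and \<open>r\<close> has at most \<open>r + s^2\<close> edges (\<open>card_no_rectangle_le\<close>), which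
  here is \<open>o(t^2)\<close>. The same holds with the factors exchanged, and so \<open>t^2 - O(t) \<le> o(t^2)\<close>
  (\<open>window_count\<close>), which is absurd.
\<close>

section \<open>The gap principle for shifted powers\<close>

lemma power_gap:
  fixes p q :: int
  assumes "0 \<le> p" "p < q" "k \<ge> 1"
  shows "p ^ k + q ^ (k - 1) \<le> q ^ k"
proof -
  obtain j where k: "k = Suc j" using assms(3) by (cases k) auto
  have "p ^ k \<le> (q - 1) * q ^ j"
    unfolding k power_Suc using assms by (intro mult_mono power_mono) auto
  thus ?thesis by (simp add: k algebra_simps)
qed

text \<open>
  With \<open>p = x1 x4\<close>, \<open>q = x2 x3\<close> and \<open>D = (a2 - a1)(b2 - b1)\<close>, expanding
  \<open>(a1 b1)(a2 b2) = (a1 b2)(a2 b1)\<close> gives \<open>p^k - q^k = - n D\<close>. This is nonzero, so its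
  absolute value is at least \<open>p^(k - 1)\<close>, while \<open>0 < D \<le> x4^k\<close>
  because \<open>D = x4^k - x3^k - (x2^k - x1^k)\<close> and \<open>x1 < x2\<close>. Cancelling \<open>x4^(k - 1)\<close>
  leaves \<open>x1^(k - 1) \<le> \<bar>n\<bar> x4\<close>.
\<close>

lemma rectangle_root_gap:
  fixes a1 a2 b1 b2 x1 x2 x3 x4 k :: nat and n :: int
  assumes k: "k \<ge> 3" and n: "n \<noteq> 0"
    and lt: "a1 < a2" "b1 < b2" and pos: "0 < a1" "0 < x1"
    and e1: "int (a1 * b1) = int x1 ^ k + n"
    and e2: "int (a1 * b2) = int x2 ^ k + n"
    and e3: "int (a2 * b1) = int x3 ^ k + n"
    and e4: "int (a2 * b2) = int x4 ^ k + n"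
  shows "int x1 ^ 2 \<le> \<bar>n\<bar> * int x4"
proof -
  define D where "D = (int a2 - int a1) * (int b2 - int b1)"
  define p where "p = int x1 * int x4"
  define q where "q = int x2 * int x3"
  have D_pos: "D > 0" using lt unfolding D_def by simp
  have D_eq: "D = int x1 ^ k + int x4 ^ k - int x2 ^ k - int x3 ^ k"
    using e1 e2 e3 e4 unfolding D_def by (simp add: algebra_simps)
  have "int (a1 * b1) < int (a1 * b2)" using lt pos by simp
  hence "int x1 ^ k < int x2 ^ k" using e1 e2 by linarith
  moreover have "int x3 ^ k \<ge> 0" by simp
  ultimately have D_le: "D \<le> int x4 ^ k" using D_eq by linarith
  have "(int x1 ^ k + n) * (int x4 ^ k + n) = (int x2 ^ k + n) * (int x3 ^ k + n)"
    unfolding e1[symmetric] e2[symmetric] e3[symmetric] e4[symmetric] by simp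
  hence diff: "p ^ k - q ^ k = - (n * D)"
    unfolding p_def q_def power_mult_distrib D_eq by (simp add: algebra_simps)
  have nonneg: "p \<ge> 0" "q \<ge> 0" by (simp_all add: p_def q_def)
  have "p \<noteq> q" using diff n D_pos by auto
  hence "p ^ (k - 1) \<le> \<bar>p ^ k - q ^ k\<bar>"
  proof (rule linorder_neqE)
    assume "p < q"
    have "p ^ (k - 1) \<le> q ^ (k - 1)" using \<open>p < q\<close> nonneg by (intro power_mono) auto
    thus ?thesis using power_gap[of p q k] \<open>p < q\<close> nonneg k by linarith
  next
    assume "q < p"
    thus ?thesis using power_gap[of q p k] nonneg k by linarith
  qed
  also have "\<dots> = \<bar>n\<bar> * D" using diff D_pos by (simp add: abs_mult)
  also have "\<dots> \<le> \<bar>n\<bar> * int x4 ^ k" using D_le by (intro mult_left_mono) auto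
  also have "\<dots> = (\<bar>n\<bar> * int x4) * int x4 ^ (k - 1)"
    using k by (cases k) (simp_all add: mult_ac)
  finally have *: "int x1 ^ (k - 1) * int x4 ^ (k - 1) \<le> (\<bar>n\<bar> * int x4) * int x4 ^ (k - 1)"
    by (simp add: p_def power_mult_distrib)
  have "int x4 ^ k > 0" using D_pos D_le by linarith
  hence "x4 > 0" using k by (cases "x4 = 0") (auto simp: power_0_left split: if_splits)
  hence "int x1 ^ (k - 1) \<le> \<bar>n\<bar> * int x4" using * by simp
  moreover have "int x1 ^ 2 \<le> int x1 ^ (k - 1)"
    using k pos by (intro power_increasing) auto
  ultimately show ?thesis by linarith
qed

section \<open>Bipartite graphs without 4-cycles\<close>

text \<open>
  Call the least neighbour of \<open>b\<close> in \<open>S\<close> its leader \<open>l b\<close>. There is at most one edge to a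
  leader for each \<open>b\<close>. Any other edge \<open>(a, b)\<close> is determined by the pair \<open>(l b, a)\<close> of
  distinct elements of \<open>S\<close>, as two elements of \<open>T\<close> with the same two neighbours would close
  a 4-cycle.
\<close>

lemma card_no_rectangle_le:
  fixes P :: "(nat \<times> nat) set"
  assumes fin: "finite S" "finite T" and sub: "P \<subseteq> S \<times> T"
    and no_rect: "\<And>a a' b b'. a \<noteq> a' \<Longrightarrow> b \<noteq> b' \<Longrightarrow> (a, b) \<in> P \<Longrightarrow> (a, b') \<in> P \<Longrightarrow>
      (a', b) \<in> P \<Longrightarrow> (a', b') \<in> P \<Longrightarrow> False"
  shows "card P \<le> card T + card S ^ 2"
proof -
  define l where "l b = (LEAST a. (a, b) \<in> P)" for b
  have l: "(l b, b) \<in> P" if "(a, b) \<in> P" for a b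
    using that unfolding l_def by (rule LeastI)
  define P0 where "P0 = {(a, b) \<in> P. a = l b}"
  define P1 where "P1 = {(a, b) \<in> P. a \<noteq> l b}"
  have P: "P = P0 \<union> P1" unfolding P0_def P1_def by auto
  have "card P0 \<le> card T"
    by (rule card_inj_on_le[where f = snd]) (use sub fin in \<open>auto simp: P0_def inj_on_def\<close>)
  moreover have "card P1 \<le> card (S \<times> S)"
  proof (rule card_inj_on_le[where f = "\<lambda>(a, b). (l b, a)"])
    show "inj_on (\<lambda>(a, b). (l b, a)) P1"
    proof (rule inj_onI, clarsimp)
      fix a b b' assume "(a, b) \<in> P1" "(a, b') \<in> P1" "l b = l b'"
      thus "b = b'"
        using no_rect[of "l b" a b b'] l[of a b] l[of a b'] unfolding P1_def by auto
    qed
    show "(\<lambda>(a, b). (l b, a)) ` P1 \<subseteq> S \<times> S"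
      using sub l by (auto simp: P1_def)
  qed (use fin in auto)
  moreover have "card (S \<times> S) = card S ^ 2"
    by (simp add: card_cartesian_product power2_eq_square)
  ultimately show ?thesis
    using card_Un_le[of P0 P1] unfolding P by linarith
qed

section \<open>Negligible sets\<close>

text \<open>
  Having \<open>o(X^(1/k))\<close> elements up to \<open>X\<close>, tested along the perfect powers \<open>X = t^k\<close> only:
  the bound then reads \<open>o(t)\<close> and no fractional powers occur.
\<close>

definition negligible :: "nat \<Rightarrow> nat set \<Rightarrow> bool" where
  "negligible k S \<longleftrightarrow> (\<lambda>t::nat. real (card {s \<in> S. s \<le> t ^ k})) \<in> o(\<lambda>t. real t)"

lemma negligible_compose:
  assumes "negligible k S" "filterlim g at_top at_top"
  shows "(\<lambda>t::nat. real (card {s \<in> S. s \<le> g t ^ k})) \<in> o(\<lambda>t. real (g t))"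
  using landau_o.small.compose[OF assms(1)[unfolded negligible_def] assms(2)] .

lemma negligible_dominated:
  assumes "f \<in> o(\<lambda>t. real t)" "\<And>t. real (card {s \<in> S. s \<le> t ^ k}) \<le> f t"
  shows "negligible k S"
  unfolding negligible_def
  by (rule landau_o.big_small_trans[OF _ assms(1)])
     (use assms(2) in \<open>auto intro!: landau_o.big_mono always_eventually 
       simp: order.trans[OF _ abs_ge_self]\<close>)

lemma negligible_subset:
  assumes "negligible k S" "S' \<subseteq> S"
  shows "negligible k S'"
  by (rule negligible_dominated[OF assms(1)[unfolded negligible_def]])
     (use assms(2) in \<open>auto intro!: card_mono\<close>)

lemma negligible_Un:
  assumes "negligible k S" "negligible k S'"
  shows "negligible k (S \<union> S')"
proof (rule negligible_dominated)
  show "(\<lambda>t. real (card {s \<in> S. s \<le> t ^ k}) + real (card {s \<in> S'. s \<le> t ^ k})) \<in> o(\<lambda>t. real t)"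
    using assms unfolding negligible_def by (rule sum_in_smallo)
  fix t
  have "{s \<in> S \<union> S'. s \<le> t ^ k} = {s \<in> S. s \<le> t ^ k} \<union> {s \<in> S'. s \<le> t ^ k}" by auto
  thus "real (card {s \<in> S \<union> S'. s \<le> t ^ k})
      \<le> real (card {s \<in> S. s \<le> t ^ k}) + real (card {s \<in> S'. s \<le> t ^ k})"
    using card_Un_le[of "{s \<in> S. s \<le> t ^ k}" "{s \<in> S'. s \<le> t ^ k}"] by simp
qed

text \<open>
  Multiplication by \<open>b\<close> maps the elements up to \<open>t^k\<close> into \<open>S\<close> up to \<open>(b t)^k\<close>, and
  \<open>o(b t) = o(t)\<close>.
\<close>

lemma negligible_quotient:
  assumes "negligible k S" "b > 0" "k \<ge> 1"
  shows "negligible k {a. a * b \<in> S}"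
proof (rule negligible_dominated)
  have "filterlim (\<lambda>t::nat. b * t) at_top at_top"
    using assms(2) by (intro filterlim_subseq) (auto simp: strict_mono_def)
  from negligible_compose[OF assms(1) this]
  show "(\<lambda>t. real (card {s \<in> S. s \<le> (b * t) ^ k})) \<in> o(\<lambda>t. real t)"
    using assms(2) by simp
  fix t
  have "card {a \<in> {a. a * b \<in> S}. a \<le> t ^ k} \<le> card {s \<in> S. s \<le> (b * t) ^ k}"
  proof (rule card_inj_on_le[where f = "\<lambda>a. a * b"])
    have "a * b \<le> (b * t) ^ k" if "a \<le> t ^ k" for a
    proof -
      have "a * b \<le> t ^ k * b ^ k"
        using that assms by (intro mult_mono self_le_power) auto
      thus ?thesis by (simp add: power_mult_distrib mult.commute)
    qed
    thus "(\<lambda>a. a * b) ` {a \<in> {a. a * b \<in> S}. a \<le> t ^ k} \<subseteq> {s \<in> S. s \<le> (b * t) ^ k}" by auto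
  qed (use assms in \<open>auto simp: inj_on_def\<close>)
  thus "real (card {a \<in> {a. a * b \<in> S}. a \<le> t ^ k}) \<le> real (card {s \<in> S. s \<le> (b * t) ^ k})"
    by simp
qed

lemma negligible_of_real_count:
  assumes k: "k \<ge> 1"
    and S: "(\<lambda>X::real. real (card {m \<in> S. real m \<le> X})) \<in> o[at_top](\<lambda>X. X powr (1 / real k))"
  shows "negligible k S"
proof -
  have "filterlim (\<lambda>t::nat. real (t ^ k)) at_top at_top"
    using k by (intro filterlim_compose[OF filterlim_real_sequentially] filterlim_pow_at_top
        filterlim_subseq) (auto simp: strict_mono_def power_strict_mono)
  from landau_o.small.compose[OF S this]
  have "(\<lambda>t::nat. real (card {m \<in> S. m \<le> t ^ k})) \<in> o(\<lambda>t. real (t ^ k) powr (1 / real k))"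
    by (simp del: of_nat_power)
  also have "(\<lambda>t::nat. real (t ^ k) powr (1 / real k)) = (\<lambda>t. real t)"
    using k by (auto simp: fun_eq_iff powr_powr simp flip: powr_realpow')
  finally show ?thesis unfolding negligible_def .
qed

section \<open>The factors are negligible\<close>

text \<open>
  The shift is absorbed into the constant factor, so that the roots of all \<open>m = O(y^k)\<close> are
  \<open>O(y)\<close> with a constant valid for every \<open>y\<close>.
\<close>

lemma root_bound:
  fixes x y k c :: nat and n :: int
  assumes "int m = int x ^ k + n" "m \<le> c * y ^ k" "y > 0" "k \<ge> 1"
  shows "x \<le> (c + nat \<bar>n\<bar>) * y"
proof -
  have "int x ^ k \<le> int m + \<bar>n\<bar>" using assms(1) by linarith
  hence "int (x ^ k) \<le> int (m + nat \<bar>n\<bar>)" by simp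
  hence "x ^ k \<le> m + nat \<bar>n\<bar>" by (simp only: of_nat_le_iff)
  also have "\<dots> \<le> c * y ^ k + nat \<bar>n\<bar> * y ^ k"
    using assms by (intro add_mono) auto
  also have "\<dots> = (c + nat \<bar>n\<bar>) * y ^ k" by (simp add: algebra_simps)
  also have "\<dots> \<le> (c + nat \<bar>n\<bar>) ^ k * y ^ k"
  proof (cases "c + nat \<bar>n\<bar> = 0")
    case False
    thus ?thesis using assms by (intro mult_right_mono self_le_power) auto
  qed simp
  finally have "x ^ k \<le> ((c + nat \<bar>n\<bar>) * y) ^ k" by (simp add: power_mult_distrib)
  thus ?thesis using assms(4) by (simp add: power_mono_iff)
qed

lemma card_squares_le: "real (card {x::nat. x ^ 2 \<le> N}) \<le> 1 + sqrt (real N)"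
proof -
  have "{x::nat. x ^ 2 \<le> N} \<subseteq> {..nat \<lfloor>sqrt (real N)\<rfloor>}"
  proof (clarsimp simp: le_nat_floor)
    fix x :: nat assume "x ^ 2 \<le> N"
    hence "real x ^ 2 \<le> real N" by (metis of_nat_le_iff of_nat_power)
    hence "real x \<le> sqrt (real N)" by (rule real_le_rsqrt)
    thus "x \<le> nat \<lfloor>sqrt (real N)\<rfloor>" by (rule le_nat_floor)
  qed
  hence "card {x::nat. x ^ 2 \<le> N} \<le> card {..nat \<lfloor>sqrt (real N)\<rfloor>}" by (rule card_mono[rotated]) simp
  hence "card {x::nat. x ^ 2 \<le> N} \<le> 1 + nat \<lfloor>sqrt (real N)\<rfloor>" by simp
  hence "real (card {x::nat. x ^ 2 \<le> N}) \<le> real (1 + nat \<lfloor>sqrt (real N)\<rfloor>)"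
    by (simp only: of_nat_le_iff)
  hence "real (card {x::nat. x ^ 2 \<le> N}) \<le> 1 + real (nat \<lfloor>sqrt (real N)\<rfloor>)"
    by (simp only: of_nat_add of_nat_1)
  also have "real (nat \<lfloor>sqrt (real N)\<rfloor>) \<le> sqrt (real N)" by (simp add: of_nat_floor)
  finally show ?thesis by simp
qed

text \<open>
  Two elements \<open>a < a'\<close> of the set form a rectangle with \<open>b1\<close> and \<open>b2\<close>. For \<open>a' \<le> t^k\<close>
  the largest root is \<open>O(t)\<close>, so by the gap principle the root of \<open>a * b1\<close> is
  \<open>O(sqrt t)\<close>. This applies to every \<open>a\<close> in the set up to \<open>t^k\<close> except the largest, and the
  root determines \<open>a\<close>.
\<close>

lemma negligible_common_quotients:
  assumes k: "k \<ge> 3" and n: "n \<noteq> 0" and b: "0 < b1" "b1 < b2"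
  shows "negligible k {a. a * b1 \<in> shifted_powers k n \<and> a * b2 \<in> shifted_powers k n}"
    (is "negligible k ?T")
proof (rule negligible_dominated)
  define C where "C = nat \<bar>n\<bar> * (b2 + nat \<bar>n\<bar>)"
  show "(\<lambda>t. 2 + sqrt (real C) * sqrt (real t)) \<in> o(\<lambda>t. real t)"
  proof (rule sum_in_smallo)
    show "(\<lambda>t. 2) \<in> o(\<lambda>t. real t)"
      by real_asymp
    show "(\<lambda>t. sqrt (real C) * sqrt (real t)) \<in> o(\<lambda>t. real t)"
    proof (cases "C = 0")
      case False
      have "(\<lambda>t. sqrt (real t)) \<in> o(\<lambda>t. real t)" by real_asymp
      thus ?thesis using False by (subst landau_o.small.cmult_in_iff) auto
    qed simp
  qed
  fix t :: nat
  define F where "F = {a \<in> ?T. a \<le> t ^ k}"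
  have finF: "finite F" unfolding F_def by simp
  define r where "r a = (SOME x. 0 < x \<and> int (a * b1) = int x ^ k + n)" for a
  have r: "0 < r a \<and> int (a * b1) = int (r a) ^ k + n" if "a \<in> ?T" for a
    unfolding r_def by (rule someI_ex) (use that in \<open>auto simp: shifted_powers_def\<close>)
  have small: "r a ^ 2 \<le> C * t" if "a \<in> F" "a' \<in> F" "a < a'" for a a'
  proof -
    have T: "a \<in> ?T" "a' \<in> ?T" "a' \<le> t ^ k" using that unfolding F_def by auto
    obtain x2 where x2: "int (a * b2) = int x2 ^ k + n"
      using T unfolding shifted_powers_def by auto
    obtain x4 where x4: "int (a' * b2) = int x4 ^ k + n"
      using T unfolding shifted_powers_def by auto
    have "a > 0" using T unfolding shifted_powers_def by (cases a) auto
    have "t > 0" using T(3) that(3) k by (cases "t = 0") (auto simp: power_0_left)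
    have "int (r a) ^ 2 \<le> \<bar>n\<bar> * int x4"
      by (rule rectangle_root_gap[OF k n that(3) b(2), where ?x2.0 = x2 and ?x3.0 = "r a'"])
         (use r[OF T(1)] r[OF T(2)] x2 x4 \<open>a > 0\<close> in auto)
    hence "int (r a ^ 2) \<le> int (nat \<bar>n\<bar> * x4)" by simp
    hence "r a ^ 2 \<le> nat \<bar>n\<bar> * x4" by (simp only: of_nat_le_iff)
    also have "x4 \<le> (b2 + nat \<bar>n\<bar>) * t"
      by (rule root_bound[OF x4]) (use T \<open>t > 0\<close> k in auto)
    finally show ?thesis unfolding C_def by (simp add: mult.assoc)
  qed
  have "card (F - {Max F}) \<le> card {x. x ^ 2 \<le> C * t}"
  proof (rule card_inj_on_le[where f = r])
    show "inj_on r (F - {Max F})"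
    proof (rule inj_onI)
      fix a a' assume "a \<in> F - {Max F}" "a' \<in> F - {Max F}" "r a = r a'"
      hence "int (a * b1) = int (a' * b1)" using r[of a] r[of a'] by (auto simp: F_def)
      hence "a * b1 = a' * b1" by (simp only: of_nat_eq_iff)
      thus "a = a'" using b by simp
    qed
    show "r ` (F - {Max F}) \<subseteq> {x. x ^ 2 \<le> C * t}"
    proof clarify
      fix a assume "a \<in> F" "a \<noteq> Max F"
      moreover have "Max F \<in> F" "a \<le> Max F" using \<open>a \<in> F\<close> finF by (auto intro: Max_in)
      ultimately show "r a ^ 2 \<le> C * t" using small[of a "Max F"] by simp
    qed
    show "finite {x::nat. x ^ 2 \<le> C * t}"
      by (rule finite_subset[of _ "{..C * t}"]) (auto simp: power2_nat_le_imp_le)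
  qed
  hence "real (card (F - {Max F})) \<le> 1 + sqrt (real (C * t))"
    using card_squares_le[of "C * t"] by linarith
  moreover have "card F \<le> 1 + card (F - {Max F})"
    using card_Diff_singleton_if[of F "Max F"] by (auto split: if_splits)
  ultimately show "real (card {a \<in> ?T. a \<le> t ^ k}) \<le> 2 + sqrt (real C) * sqrt (real t)"
    unfolding F_def[symmetric] by (simp add: real_sqrt_mult)
qed

lemma at_least_two_elementsE:
  assumes "at_least_two_elements A"
  obtains a a' where "a \<in> A" "a' \<in> A" "a < a'"
proof -
  have "\<exists>a\<in>A. \<exists>a'\<in>A. a \<noteq> a'"
  proof (rule ccontr)
    assume "\<not> ?thesis"
    hence "card A \<le> Suc 0 \<and> finite A"
      by (metis (full_types) card_le_Suc0_iff_eq finite.simps infinite_imp_nonempty finite_subset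
          insert_iff subsetI)
    thus False using assms unfolding at_least_two_elements_def by auto
  qed
  thus ?thesis using that by (metis linorder_neqE_nat)
qed

text \<open>
  Fix \<open>b1 < b2\<close> in \<open>B\<close>. An element \<open>a\<close> of \<open>A\<close> either has an exceptional product \<open>a * b1\<close>
  or \<open>a * b2\<close>, or is a common quotient of two shifted powers by \<open>b1\<close> and \<open>b2\<close>.
\<close>

lemma negligible_factor:
  assumes k: "k \<ge> 3" and n: "n \<noteq> 0"
    and R: "R = A * B" and pos: "B \<subseteq> {0<..}"
    and two: "at_least_two_elements B"
    and E: "negligible k (R - shifted_powers k n)"
  shows "negligible k A"
proof -
  obtain b1 b2 where b: "b1 \<in> B" "b2 \<in> B" "b1 < b2"
    using two by (rule at_least_two_elementsE)
  have b_pos: "0 < b1" "0 < b2" using b pos by auto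
  let ?M = "shifted_powers k n"
  have "A \<subseteq> {a. a * b1 \<in> R - ?M} \<union> {a. a * b2 \<in> R - ?M} \<union> {a. a * b1 \<in> ?M \<and> a * b2 \<in> ?M}"
    using b unfolding R by (auto intro: set_times_intro)
  moreover have "negligible k ({a. a * b1 \<in> R - ?M} \<union> {a. a * b2 \<in> R - ?M}
      \<union> {a. a * b1 \<in> ?M \<and> a * b2 \<in> ?M})"
    by (intro negligible_Un negligible_quotient negligible_common_quotients E) (use k n b b_pos in auto)
  ultimately show ?thesis by (rule negligible_subset[rotated])
qed

section \<open>Counting products in a short range of roots\<close>

text \<open>
  The edges of the graph. For \<open>n \<noteq> 0\<close>, since \<open>(\<bar>n\<bar> t)^2 \<ge> \<bar>n\<bar> t^2\<close>, no two roots \<open>x1\<close>, \<open>x4\<close> in the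
  range between \<open>\<bar>n\<bar> t\<close> and \<open>t^2\<close> satisfy \<open>x1^2 \<le> \<bar>n\<bar> x4\<close>; yet the range contains almost
  all roots up to \<open>t^2\<close>.
\<close>

definition window_pairs :: "nat \<Rightarrow> int \<Rightarrow> nat \<Rightarrow> (nat \<times> nat) set" where
  "window_pairs k n t = {(a, b). 0 < a \<and> 0 < b \<and>
     (\<exists>x. nat \<bar>n\<bar> * t < x \<and> x \<le> t ^ 2 \<and> int (a * b) = int x ^ k + n)}"

lemma window_pairs_ordered:
  assumes k: "k \<ge> 3" and n: "n \<noteq> 0" and lt: "a < a'" "b < b'"
    and P: "(a, b) \<in> window_pairs k n t" "(a, b') \<in> window_pairs k n t"
      "(a', b) \<in> window_pairs k n t" "(a', b') \<in> window_pairs k n t"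
  shows False
proof -
  obtain x1 where x1: "nat \<bar>n\<bar> * t < x1" "int (a * b) = int x1 ^ k + n" and "0 < a"
    using P(1) unfolding window_pairs_def by auto
  obtain x2 where x2: "int (a * b') = int x2 ^ k + n" using P(2) unfolding window_pairs_def by auto
  obtain x3 where x3: "int (a' * b) = int x3 ^ k + n" using P(3) unfolding window_pairs_def by auto
  obtain x4 where x4: "x4 \<le> t ^ 2" "int (a' * b') = int x4 ^ k + n"
    using P(4) unfolding window_pairs_def by auto
  have "int x1 ^ 2 \<le> \<bar>n\<bar> * int x4"
    by (rule rectangle_root_gap[OF k n lt \<open>0 < a\<close> _ x1(2) x2 x3 x4(2)]) (use x1 in auto)
  also have "\<dots> \<le> \<bar>n\<bar> * int t ^ 2"
    using x4(1) by (intro mult_left_mono) (auto simp flip: of_nat_power)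
  also have "\<dots> \<le> \<bar>n\<bar> ^ 2 * int t ^ 2"
    using n by (intro mult_right_mono self_le_power) auto
  also have "\<dots> = int (nat \<bar>n\<bar> * t) ^ 2" by (simp add: power_mult_distrib)
  also have "\<dots> < int x1 ^ 2"
  proof (rule power_strict_mono)
    show "int (nat \<bar>n\<bar> * t) < int x1" using x1(1) by (simp only: of_nat_less_iff)
  qed auto
  finally show False by simp
qed

lemma window_pairs_no_rectangle:
  assumes "k \<ge> 3" "n \<noteq> 0" "a \<noteq> a'" "b \<noteq> b'"
    and "(a, b) \<in> window_pairs k n t" "(a, b') \<in> window_pairs k n t"
      "(a', b) \<in> window_pairs k n t" "(a', b') \<in> window_pairs k n t"
  shows False
  using assms window_pairs_ordered[of k n a a' b b' t] window_pairs_ordered[of k n a a' b' b t]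
    window_pairs_ordered[of k n a' a b b' t] window_pairs_ordered[of k n a' a b' b t]
  by (metis linorder_neqE_nat)

lemma window_pairs_swap: "(b, a) \<in> window_pairs k n t \<longleftrightarrow> (a, b) \<in> window_pairs k n t"
  unfolding window_pairs_def by (auto simp: mult.commute)

lemma card_window_pairs_le:
  assumes k: "k \<ge> 3" and n: "n \<noteq> 0"
  shows "card {(a, b) \<in> window_pairs k n t. a \<in> A \<and> b \<in> B \<and> a \<le> U \<and> b \<le> V}
    \<le> card {b \<in> B. b \<le> V} + card {a \<in> A. a \<le> U} ^ 2"
  by (rule card_no_rectangle_le)
     (auto intro: window_pairs_no_rectangle[OF k n])

text \<open>
  Each \<open>x\<close> with \<open>\<bar>n\<bar> t < x \<le> t^2\<close> yields a different shifted power. It is either outside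
  \<open>R\<close> or a product \<open>a * b\<close>; in the latter case \<open>a * b \<le> ((c t)^k)^2\<close>, so one of the
  factors is at most \<open>(c t)^k\<close>. The two bracketed terms bound the number of edges for which
  this factor is \<open>a\<close> or \<open>b\<close>, respectively.
\<close>

lemma window_count:
  assumes k: "k \<ge> 3" and n: "n \<noteq> 0" and R: "R = A * B"
    and pos: "A \<subseteq> {0<..}" "B \<subseteq> {0<..}" and t: "t > 0"
  defines "c \<equiv> 1 + nat \<bar>n\<bar>"
  shows "t ^ 2 \<le> nat \<bar>n\<bar> * t + card {m \<in> shifted_powers k n - R. m \<le> (c * t ^ 2) ^ k}
    + (card {b \<in> B. b \<le> (c * t ^ 2) ^ k} + card {a \<in> A. a \<le> (c * t) ^ k} ^ 2)
    + (card {a \<in> A. a \<le> (c * t ^ 2) ^ k} + card {b \<in> B. b \<le> (c * t) ^ k} ^ 2)"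
proof -
  let ?X = "(c * t ^ 2) ^ k" and ?Y = "(c * t) ^ k"
  define I where "I = {nat \<bar>n\<bar> * t <.. t ^ 2}"
  define E where "E = {m \<in> shifted_powers k n - R. m \<le> ?X}"
  define P1 where "P1 = {(a, b) \<in> window_pairs k n t. a \<in> A \<and> b \<in> B \<and> a \<le> ?Y \<and> b \<le> ?X}"
  define P2 where "P2 = {(b, a) \<in> window_pairs k n t. b \<in> B \<and> a \<in> A \<and> b \<le> ?Y \<and> a \<le> ?X}"
  \<comment> \<open>No value is truncated by \<open>nat\<close> on \<open>I\<close>: there \<open>x > \<bar>n\<bar>\<close>, as \<open>t > 0\<close>.\<close>
  define h where "h x = nat (int x ^ k + n)" for x :: nat
  have finP: "finite P1" "finite P2"
    by (rule finite_subset[of _ "{..?Y} \<times> {..?X}"], auto simp: P1_def P2_def)+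
  have h: "int (h x) = int x ^ k + n" "h x > 0" if "x \<in> I" for x
  proof -
    have "nat \<bar>n\<bar> * 1 \<le> nat \<bar>n\<bar> * t" using t by (intro mult_left_mono) auto
    hence "nat \<bar>n\<bar> < x" using that unfolding I_def greaterThanAtMost_iff by linarith
    also have "x \<le> x ^ k" using \<open>nat \<bar>n\<bar> < x\<close> k by (intro self_le_power) auto
    finally have "int (nat \<bar>n\<bar>) < int (x ^ k)" by (simp only: of_nat_less_iff)
    hence "int x ^ k + n > 0" by simp
    thus "int (h x) = int x ^ k + n" "h x > 0" unfolding h_def by auto
  qed
  have h_le: "h x \<le> ?X" if "x \<in> I" for x
  proof -
    have "int (h x) \<le> int (x ^ k + nat \<bar>n\<bar>)" using h(1)[OF that] by simp
    hence "h x \<le> x ^ k + nat \<bar>n\<bar>" by (simp only: of_nat_le_iff)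
    also have "\<dots> \<le> (t ^ 2) ^ k + nat \<bar>n\<bar> * (t ^ 2) ^ k"
      using that t unfolding I_def by (intro add_mono power_mono) auto
    also have "\<dots> = c * (t ^ 2) ^ k" unfolding c_def by (simp add: algebra_simps)
    also have "\<dots> \<le> c ^ k * (t ^ 2) ^ k"
      using k unfolding c_def by (intro mult_right_mono self_le_power) auto
    finally show ?thesis by (simp add: power_mult_distrib)
  qed
  have inj: "inj_on h I"
  proof (rule inj_onI)
    fix x y assume "x \<in> I" "y \<in> I" "h x = h y"
    hence "int x ^ k = int y ^ k" using h(1)[of x] h(1)[of y] by simp
    thus "x = y" using k by (simp add: power_eq_iff_eq_base flip: of_nat_power)
  qed
  have sub: "h ` I \<subseteq> E \<union> (\<lambda>(a, b). a * b) ` P1 \<union> (\<lambda>(a, b). a * b) ` P2"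
  proof clarify
    fix x assume x: "x \<in> I" and nP2: "h x \<notin> (\<lambda>(a, b). a * b) ` P2"
      and nP1: "h x \<notin> (\<lambda>(a, b). a * b) ` P1"
    show "h x \<in> E"
    proof (rule ccontr)
      assume "h x \<notin> E"
      moreover have "h x \<in> shifted_powers k n"
        using h[OF x] x unfolding shifted_powers_def I_def by (auto intro!: exI[of _ x])
      ultimately have "h x \<in> A * B" using h_le[OF x] unfolding E_def R by auto
      then obtain a b where ab: "a \<in> A" "b \<in> B" "h x = a * b" by (rule set_times_elim)
      have ab0: "a > 0" "b > 0" using ab pos by auto
      have W: "(a, b) \<in> window_pairs k n t"
        using h(1)[OF x] x ab ab0 unfolding window_pairs_def I_def by auto
      have prod: "a * b \<le> ?X" using h_le[OF x] ab by simp
      have "a \<le> a * b" "b \<le> a * b" using ab0 by auto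
      hence le: "a \<le> ?X" "b \<le> ?X" using prod by linarith+
      have "?X \<le> (c ^ 2 * t ^ 2) ^ k"
        unfolding c_def by (intro power_mono mult_right_mono self_le_power) auto
      also have "\<dots> = ?Y * ?Y" by (simp add: power2_eq_square power_mult_distrib mult_ac)
      finally have XY: "a * b \<le> ?Y * ?Y" using prod by linarith
      have "a \<le> ?Y \<or> b \<le> ?Y"
      proof (rule ccontr)
        assume "\<not> ?thesis"
        hence "?Y * ?Y < a * b" by (intro mult_strict_mono) auto
        thus False using XY by simp
      qed
      thus False
      proof
        assume "a \<le> ?Y"
        hence "(a, b) \<in> P1" using W ab le unfolding P1_def by auto
        thus False using nP1 ab by (auto simp: image_iff)
      next
        assume "b \<le> ?Y"
        hence "(b, a) \<in> P2" using W ab le unfolding P2_def by (auto simp: window_pairs_swap)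
        thus False using nP2 ab by (force simp: image_iff mult.commute)
      qed
    qed
  qed
  have "card I = card (h ` I)" using inj by (simp add: card_image)
  also have "\<dots> \<le> card (E \<union> (\<lambda>(a, b). a * b) ` P1 \<union> (\<lambda>(a, b). a * b) ` P2)"
    by (rule card_mono[OF _ sub]) (use finP in \<open>auto simp: E_def\<close>)
  also have "\<dots> \<le> card E + card ((\<lambda>(a, b). a * b) ` P1) + card ((\<lambda>(a, b). a * b) ` P2)"
    by (meson add_mono card_Un_le order.trans order_refl)
  also have "\<dots> \<le> card E + card P1 + card P2"
    using finP by (intro add_mono card_image_le) auto
  finally have "t ^ 2 \<le> nat \<bar>n\<bar> * t + card E + card P1 + card P2" unfolding I_def by simp
  thus ?thesis
    using card_window_pairs_le[OF k n, of t A B ?Y ?X] card_window_pairs_le[OF k n, of t B A ?Y ?X]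
    unfolding E_def P1_def P2_def by linarith
qed

section \<open>Irreducibility\<close>

theorem theorem1p3:
  fixes k :: nat and n :: int and M R :: "nat set"
  assumes "k \<ge> 3" and "n \<noteq> 0"
    and "M = shifted_powers k n"
    and "R \<subseteq> {0<..}"
    and "(\<lambda>X::real. real (card {m \<in> (R - M) \<union> (M - R). real m \<le> X}))
           \<in> o[at_top](\<lambda>X. X powr (1 / real k))"
  shows "mult_irreducible R"
  unfolding mult_irreducible_def
proof
  assume "mult_reducible R"
  then obtain A B where AB: "A \<subseteq> {0<..}" "B \<subseteq> {0<..}" "R = A * B"
    "at_least_two_elements A" "at_least_two_elements B"
    unfolding mult_reducible_def by auto
  have E: "negligible k ((R - M) \<union> (M - R))"
    using assms by (intro negligible_of_real_count) auto
  have RM: "negligible k (R - shifted_powers k n)" and MR: "negligible k (shifted_powers k n - R)"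
    by (rule negligible_subset[OF E], use assms in auto)+
  have A: "negligible k A" using negligible_factor[OF assms(1,2) AB(3,2,5) RM] .
  have "R = B * A" using AB(3) by (simp add: mult.commute)
  hence B: "negligible k B" using negligible_factor[OF assms(1,2) _ AB(1,4) RM] by blast
  define c where "c = 1 + nat \<bar>n\<bar>"
  have c_pos: "c > 0" by (simp add: c_def)
  define cnt where "cnt S g t = real (card {s \<in> S. s \<le> g t ^ k})"
    for S and g :: "nat \<Rightarrow> nat" and t :: nat
  \<comment> \<open>The small factor is cut off at the \<open>k\<close>-th power of \<open>?g1 t\<close>, the large factor and the
    exceptional elements at that of \<open>?g2 t\<close>. A negligible set has \<open>o(t)\<close> elements below the
    former and \<open>o(t^2)\<close> below the latter.\<close>
  let ?g1 = "\<lambda>t. c * t" and ?g2 = "\<lambda>t. c * t ^ 2"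
  have lim: "filterlim ?g1 at_top at_top" "filterlim ?g2 at_top at_top"
    by (intro filterlim_subseq strict_monoI mult_strict_left_mono power_strict_mono; simp add: c_def)+
  have lin: "cnt S ?g1 \<in> o(\<lambda>t. real t)" if "negligible k S" for S
    using negligible_compose[OF that lim(1)] unfolding cnt_def using c_pos by simp
  have quad: "cnt S ?g2 \<in> o(\<lambda>t. real t ^ 2)" if "negligible k S" for S
    using negligible_compose[OF that lim(2)] unfolding cnt_def using c_pos by simp
  have sq: "(\<lambda>t. cnt S ?g1 t ^ 2) \<in> o(\<lambda>t. real t ^ 2)" if "negligible k S" for S
    using landau_o.small.mult[OF lin[OF that] lin[OF that]] by (simp add: power2_eq_square)
  define bound where "bound t = real (nat \<bar>n\<bar>) * real t + cnt (shifted_powers k n - R) ?g2 t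
    + (cnt B ?g2 t + cnt A ?g1 t ^ 2) + (cnt A ?g2 t + cnt B ?g1 t ^ 2)" for t
  have "(\<lambda>t. real (nat \<bar>n\<bar>) * real t) \<in> o(\<lambda>t. real t ^ 2)"
    by real_asymp
  hence bound: "bound \<in> o(\<lambda>t. real t ^ 2)"
    unfolding bound_def by (intro sum_in_smallo quad sq A B MR)
  have le: "real t ^ 2 \<le> bound t" if "t > 0" for t
  proof -
    have "real (t ^ 2) \<le> bound t"
      using of_nat_mono[OF window_count[OF assms(1,2) AB(3,1,2) that, folded c_def], where 'a = real]
      unfolding bound_def cnt_def by (simp only: of_nat_add of_nat_mult of_nat_power)
    thus ?thesis by simp
  qed
  have "eventually (\<lambda>t. norm (bound t) \<le> 1 / 2 * norm (real t ^ 2)) at_top"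
    using landau_o.smallD[OF bound, of "1 / 2"] by simp
  with eventually_gt_at_top[of 0] have "eventually (\<lambda>_::nat. False) at_top"
  proof eventually_elim
    case (elim t)
    hence "real t ^ 2 > 0" "\<bar>bound t\<bar> \<le> 1 / 2 * real t ^ 2" by simp_all
    thus False using le[OF elim(1)] by linarith
  qed
  thus False by simp
qed

end
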